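(* Let $q,h,k$ be positive integers with $h\geq 2$ and $h\le q/2$. For the spiro-chain $S_{q,h,k}$ we have $$ABC(S_{q,h,k})=\frac{qk}{\sqrt{2}}.$$
   Context: For a finite simple graph $G$, $ABC(G)=\sum_{uv\in E(G)}\sqrt{\frac{d_u+d_v-2}{d_ud_v}}$, where $d_u$ is the degree of $u$ in $G$ (atom-bond connectivity index). The spiro-chain $S_{q,h,k}$ is the chain of $k$ cycles $C_q$ in which the distance between two consecutive contact vertices is $h$: take $k$ disjoint copies $C^{(1)},\ldots,C^{(k)}$ of the cycle $C_q$, in each $C^{(i)}$ choose vertices $x_i,y_i$ at distance $h$, and identify $y_i$ with $x_{i+1}$ for $i=1,\ldots,k-1$. *)

theory Defs
  imports Complex_Main
begin

record 'a ugraph =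
  verts :: "'a set"
  edges :: "'a set set"

definition finite_simple_graph :: "'a ugraph \<Rightarrow> bool" where
  "finite_simple_graph G \<longleftrightarrow>
     finite (verts G) \<and> (\<forall>e\<in>edges G. e \<subseteq> verts G \<and> card e = 2)"

definition degree :: "'a ugraph \<Rightarrow> 'a \<Rightarrow> nat" where
  "degree G v = card {e \<in> edges G. v \<in> e}"

(* An edge e is a two-element set {u, v}, so the inner sum is d_u + d_v and the
   product is d_u d_v. *)
definition ABC :: "'a ugraph \<Rightarrow> real" where
  "ABC G = (\<Sum>e\<in>edges G.
     sqrt (((\<Sum>v\<in>e. real (degree G v)) - 2) / (\<Prod>v\<in>e. real (degree G v))))"

(* Length of a shortest walk from u to v; unspecified if there is none. *)
definition gdist :: "'a ugraph \<Rightarrow> 'a \<Rightarrow> 'a \<Rightarrow> nat" where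
  "gdist G u v = (LEAST n. (u, v) \<in> {(a, b). {a, b} \<in> edges G} ^^ n)"

(* The cycle C_q for q >= 3; for smaller q this is not a simple cycle. *)
definition cycle_graph :: "nat \<Rightarrow> nat ugraph" where
  "cycle_graph q =
     \<lparr>verts = {0..<q}, edges = {{j, Suc j mod q} |j. j < q}\<rparr>"

definition disjoint_copies :: "'i set \<Rightarrow> 'a ugraph \<Rightarrow> ('i \<times> 'a) ugraph" where
  "disjoint_copies I G =
     \<lparr>verts = I \<times> verts G, edges = {Pair i ` e |i e. i \<in> I \<and> e \<in> edges G}\<rparr>"

(* The quotient of G by the equivalence relation generated by r. *)
definition identify :: "('a \<Rightarrow> 'a \<Rightarrow> bool) \<Rightarrow> 'a ugraph \<Rightarrow> 'a set ugraph" where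
  "identify r G =
     (let cls = (\<lambda>u. {w. equivclp r u w})
      in \<lparr>verts = cls ` verts G, edges = (\<lambda>e. cls ` e) ` edges G\<rparr>)"

definition spiro_glue ::
  "nat \<Rightarrow> (nat \<Rightarrow> nat) \<Rightarrow> (nat \<Rightarrow> nat) \<Rightarrow> nat \<times> nat \<Rightarrow> nat \<times> nat \<Rightarrow> bool" where
  "spiro_glue k x y u w \<longleftrightarrow>
     (\<exists>i\<in>{1..<k}. u = (i, y i) \<and> w = (Suc i, x (Suc i)))"

(* The vertices x_i, y_i may be chosen arbitrarily at distance h in each copy, so this
   is a predicate covering every graph obtained from such a choice; these graphs are
   all isomorphic. *)
definition is_spiro_chain :: "nat \<Rightarrow> nat \<Rightarrow> nat \<Rightarrow> (nat \<times> nat) set ugraph \<Rightarrow> bool" where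
  "is_spiro_chain q h k S \<longleftrightarrow>
     (\<exists>x y. (\<forall>i\<in>{1..k}. x i \<in> verts (cycle_graph q) \<and> y i \<in> verts (cycle_graph q) \<and>
                gdist (cycle_graph q) (x i) (y i) = h) \<and>
            S = identify (spiro_glue k x y) (disjoint_copies {1..k} (cycle_graph q)))"

lemma gdist_ge_2D:
  assumes "gdist G u v \<ge> 2"
  shows "u \<noteq> v" and "{u, v} \<notin> edges G"
proof -
  show "u \<noteq> v"
  proof
    assume "u = v"
    hence "gdist G u v \<le> 0" unfolding gdist_def by (intro Least_le) simp
    thus False using assms by simp
  qed
  show "{u, v} \<notin> edges G"
  proof
    assume "{u, v} \<in> edges G"
    hence "gdist G u v \<le> 1" unfolding gdist_def by (intro Least_le) simp
    thus False using assms by simp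
  qed
qed

lemma equivclp_spiro_glue:
  assumes ne: "\<And>i. i \<in> {1..k} \<Longrightarrow> x i \<noteq> y i"
  shows "equivclp (spiro_glue k x y) u w \<longleftrightarrow>
           u = w \<or> spiro_glue k x y u w \<or> spiro_glue k x y w u"
proof
  assume "equivclp (spiro_glue k x y) u w"
  thus "u = w \<or> spiro_glue k x y u w \<or> spiro_glue k x y w u"
  proof (induction rule: equivclp_induct)
    case base
    show ?case by simp
  next
    case (step v w)
    let ?r = "spiro_glue k x y"
      have "?r v w \<or> ?r w v" using step.hyps(2) by auto
      moreover have "a = c" if "?r a b" "?r c b" for a b c
        using that by (auto simp: spiro_glue_def)
      moreover have "b = c" if "?r a b" "?r a c" for a b c
        using that by (auto simp: spiro_glue_def)
      moreover have False if rab: "?r a b" and rbc: "?r b c" for a b c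
      proof -
        obtain i where i: "i \<in> {1..<k}" "b = (Suc i, x (Suc i))"
          using rab by (auto simp: spiro_glue_def)
        hence "x (Suc i) = y (Suc i)" using rbc by (auto simp: spiro_glue_def)
        thus False using ne[of "Suc i"] i by simp
      qed
      ultimately show ?case using step.IH by metis
  qed
next
  assume "u = w \<or> spiro_glue k x y u w \<or> spiro_glue k x y w u"
  thus "equivclp (spiro_glue k x y) u w"
    by (metis equivclp_refl r_into_equivclp converse_r_into_equivclp)
qed

lemma finite_simple_graph_cycle:
  assumes "q \<ge> 3"
  shows "finite_simple_graph (cycle_graph q)"
proof -
  have "Suc j mod q \<noteq> j" if "j < q" for j
    using that assms by (cases "Suc j = q") auto
  thus ?thesis
    using assms by (auto simp: finite_simple_graph_def cycle_graph_def card_2_iff)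
qed

lemma finite_simple_graph_spiro_chain:
  assumes "2 \<le> h" "real h \<le> real q / 2" "is_spiro_chain q h k S"
  shows "finite_simple_graph S"
proof -
  let ?C = "cycle_graph q"
  have C: "finite_simple_graph ?C"
    using assms by (intro finite_simple_graph_cycle) linarith
  from assms(3) obtain x y where
    xy: "\<And>i. i \<in> {1..k} \<Longrightarrow> gdist ?C (x i) (y i) = h"
    and S: "S = identify (spiro_glue k x y) (disjoint_copies {1..k} ?C)"
    unfolding is_spiro_chain_def by blast
  have ne: "x i \<noteq> y i" if "i \<in> {1..k}" for i
    using xy[OF that] gdist_ge_2D(1) assms(1) by metis
  define cls where "cls = (\<lambda>u. {w. equivclp (spiro_glue k x y) u w})"
  have inj: "cls (i, a) \<noteq> cls (i, b)" if "a \<noteq> b" for i a b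
  proof
    assume "cls (i, a) = cls (i, b)"
    hence "equivclp (spiro_glue k x y) (i, a) (i, b)"
      unfolding cls_def by (metis equivclp_refl mem_Collect_eq)
    hence "(i, a) = (i, b) \<or> spiro_glue k x y (i, a) (i, b) \<or> spiro_glue k x y (i, b) (i, a)"
      using equivclp_spiro_glue[of k x y] ne by blast
    thus False
      using that by (auto simp: spiro_glue_def)
  qed
  have "card (cls ` Pair i ` e) = 2" if "e \<in> edges ?C" for i e
  proof -
    have "card e = 2" using C that by (simp add: finite_simple_graph_def)
    then obtain a b where "e = {a, b}" "a \<noteq> b" by (auto simp: card_2_iff)
    thus ?thesis using inj[of a b i] by simp
  qed
  moreover have "verts S = cls ` ({1..k} \<times> verts ?C)"
    and "edges S = {cls ` Pair i ` e |i e. i \<in> {1..k} \<and> e \<in> edges ?C}"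
    unfolding S identify_def Let_def disjoint_copies_def cls_def by auto
  ultimately show ?thesis
    using C unfolding finite_simple_graph_def by fastforce
qed

end

theory Submission
  imports Defs
begin

text \<open>
  An edge with an endpoint of degree 2 contributes \<open>sqrt (d / (2 * d)) = 1 / sqrt 2\<close> to the
  ABC index, whatever the degree \<open>d\<close> of its other endpoint. Hence a graph in which every edge has
  such an endpoint has ABC index \<open>|E| / sqrt 2\<close> (\<open>ABC_eq_if_degree_2_endpoints\<close>), and it remains to
  see that the spiro-chain is such a graph and has \<open>q * k\<close> edges.

  Both facts come from \<open>h \<ge> 2\<close>: the contact vertices \<open>x i\<close> and \<open>y i\<close> of a copy of the cycle are
  distinct and not adjacent, so every edge of the copy has an endpoint that is not a contact vertex.
  The class of this endpoint under the identification is a singleton. On the one hand, no edges are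
  gained there, so its degree is still 2 (\<open>degree_identify_singleton_class\<close>). On the other hand,
  the singleton tells which copy the edge comes from, so no two edges are merged and
  all \<open>q * k\<close> of them survive (\<open>inj_on_edge_class\<close>).
\<close>

lemma ABC_eq_if_degree_2_endpoints:
  assumes G: "finite_simple_graph G"
    and deg: "\<And>e. e \<in> edges G \<Longrightarrow> \<exists>v\<in>e. degree G v = 2"
  shows "ABC G = real (card (edges G)) / sqrt 2"
proof -
  have "edges G \<subseteq> Pow (verts G)" "finite (verts G)"
    using G by (auto simp: finite_simple_graph_def)
  hence fin: "finite (edges G)"
    by (meson finite_Pow_iff finite_subset)
  have weight:
    "sqrt (((\<Sum>v\<in>e. real (degree G v)) - 2) / (\<Prod>v\<in>e. real (degree G v))) = 1 / sqrt 2"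
    if e: "e \<in> edges G" for e
  proof -
    obtain u where u: "u \<in> e" "degree G u = 2"
      using deg[OF e] by blast
    have "card e = 2"
      using G e by (simp add: finite_simple_graph_def)
    then obtain w where w: "e = {u, w}" "u \<noteq> w"
      using u(1) by (auto simp: card_2_iff)
    \<comment> \<open>The degree of \<open>w\<close> cancels because it is not 0: the edge \<open>e\<close> itself contributes to it.\<close>
    have "degree G w > 0"
      unfolding degree_def using fin e w by (auto simp: card_gt_0_iff)
    hence "((\<Sum>v\<in>e. real (degree G v)) - 2) / (\<Prod>v\<in>e. real (degree G v)) = 1 / 2"
      using w u(2) by simp
    thus ?thesis
      by (simp only: real_sqrt_divide real_sqrt_one)
  qed
  show ?thesis
    unfolding ABC_def by (simp add: weight)
qed

text \<open>
  Two distinct indices of one edge would be successors of each other modulo \<open>q\<close>, so \<open>q\<close> would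
  divide 2; for \<open>q = 2\<close> both indices do give the edge \<open>{0, 1}\<close>.
\<close>

lemma inj_on_cycle_edge:
  assumes "q \<ge> 3"
  shows "inj_on (\<lambda>j. {j, Suc j mod q}) {..<q}"
proof (rule inj_onI)
  fix j l assume *: "j \<in> {..<q}" "l \<in> {..<q}" "{j, Suc j mod q} = {l, Suc l mod q}"
  show "j = l"
  proof (rule ccontr)
    assume "j \<noteq> l"
    hence "j = Suc l mod q" "l = Suc j mod q"
      using *(3) by (auto simp: doubleton_eq_iff)
    moreover have "Suc i mod q = Suc i \<or> Suc i mod q = 0 \<and> Suc i = q" if "i < q" for i
      using that by (simp add: mod_Suc)
    ultimately have "j = Suc l \<or> j = 0 \<and> Suc l = q" "l = Suc j \<or> l = 0 \<and> Suc j = q"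
      using *(1,2) by (metis lessThan_iff)+
    thus False
      using assms by linarith
  qed
qed

lemma edges_cycle_graph: "edges (cycle_graph q) = (\<lambda>j. {j, Suc j mod q}) ` {..<q}"
  by (auto simp: cycle_graph_def)

lemma card_edges_cycle_graph:
  assumes "q \<ge> 3"
  shows "card (edges (cycle_graph q)) = q"
  using card_image[OF inj_on_cycle_edge[OF assms]] by (simp add: edges_cycle_graph)

lemma degree_cycle_graph:
  assumes "q \<ge> 3" "a < q"
  shows "degree (cycle_graph q) a = 2"
proof -
  \<comment> \<open>The edges at \<open>a\<close> are those indexed by \<open>a\<close> and by its predecessor on the cycle.\<close>
  define p where "p = (if a = 0 then q - 1 else a - 1)"
  have p: "p < q" "p \<noteq> a" "Suc p mod q = a"
    using assms by (auto simp: p_def)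
  have "j = p" if "j < q" "Suc j mod q = a" for j
    using that assms by (cases "Suc j = q") (auto simp: p_def)
  hence "{j \<in> {..<q}. a \<in> {j, Suc j mod q}} = {a, p}"
    using p(1,3) assms(2) by blast
  hence "{e \<in> edges (cycle_graph q). a \<in> e} = (\<lambda>j. {j, Suc j mod q}) ` {a, p}"
    unfolding edges_cycle_graph by blast
  moreover have "inj_on (\<lambda>j. {j, Suc j mod q}) {a, p}"
    by (rule inj_on_subset[OF inj_on_cycle_edge[OF assms(1)]]) (use p(1) assms(2) in auto)
  ultimately show ?thesis
    using p(2) by (simp add: degree_def card_image)
qed

definition glue_class :: "('a \<Rightarrow> 'a \<Rightarrow> bool) \<Rightarrow> 'a \<Rightarrow> 'a set" where
  "glue_class r u = {w. equivclp r u w}"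

lemma glue_class_singleton_eqD:
  assumes "glue_class r u = {u}" "glue_class r w = {u}"
  shows "w = u"
  using assms by (metis equivclp_refl glue_class_def mem_Collect_eq singletonD)

definition edge_class :: "('i \<times> 'a \<Rightarrow> 'i \<times> 'a \<Rightarrow> bool) \<Rightarrow> 'i \<times> 'a set \<Rightarrow> ('i \<times> 'a) set set" where
  "edge_class r p = glue_class r ` Pair (fst p) ` snd p"

lemma mem_edge_class_iff: "c \<in> edge_class r (i, e) \<longleftrightarrow> (\<exists>a\<in>e. glue_class r (i, a) = c)"
  by (auto simp: edge_class_def)

lemma edges_identify_copies:
  "edges (identify r (disjoint_copies I G)) = edge_class r ` (I \<times> edges G)"
proof -
  have "edges (disjoint_copies I G) = (\<lambda>(i, e). Pair i ` e) ` (I \<times> edges G)"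
    by (auto simp: disjoint_copies_def)
  thus ?thesis
    by (simp add: identify_def Let_def glue_class_def[symmetric] image_image edge_class_def
        case_prod_beta)
qed

text \<open>
  An endpoint that is not glued to anything survives as a singleton, and reveals the copy;
  inside a single copy, edges stay apart because vertices do.
\<close>

lemma inj_on_edge_class:
  assumes inj: "\<And>i. i \<in> I \<Longrightarrow> inj (\<lambda>a. glue_class r (i, a))"
    and free: "\<And>i e. i \<in> I \<Longrightarrow> e \<in> E \<Longrightarrow> \<exists>a\<in>e. glue_class r (i, a) = {(i, a)}"
  shows "inj_on (edge_class r) (I \<times> E)"
proof (rule inj_onI, clarify)
  fix i e j f
  assume *: "i \<in> I" "e \<in> E" "j \<in> I" "f \<in> E" "edge_class r (i, e) = edge_class r (j, f)"
  obtain a where a: "a \<in> e" "glue_class r (i, a) = {(i, a)}"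
    using free *(1,2) by blast
  hence "{(i, a)} \<in> edge_class r (j, f)"
    unfolding *(5)[symmetric] mem_edge_class_iff by blast
  then obtain b where "glue_class r (j, b) = {(i, a)}"
    by (auto simp: mem_edge_class_iff)
  hence ij: "j = i"
    using glue_class_singleton_eqD[OF a(2)] by blast
  have "(\<lambda>a. glue_class r (i, a)) ` e = (\<lambda>a. glue_class r (i, a)) ` f"
    using *(5) by (simp add: edge_class_def ij image_image)
  thus "i = j \<and> e = f"
    using inj_image_eq_iff[OF inj[OF *(1)]] ij by simp
qed

text \<open>
  Only images of edges of copy \<open>i\<close> at \<open>a\<close> can reach a vertex that nothing is glued to, and distinct
  edges have distinct images.
\<close>

lemma degree_identify_singleton_class:
  assumes i: "i \<in> I" and a: "glue_class r (i, a) = {(i, a)}"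
    and inj: "inj_on (edge_class r) (I \<times> edges G)"
  shows "degree (identify r (disjoint_copies I G)) {(i, a)} = degree G a"
proof -
  have "{(i, a)} \<in> edge_class r (j, e) \<longleftrightarrow> j = i \<and> a \<in> e" for j e
  proof
    assume "{(i, a)} \<in> edge_class r (j, e)"
    then obtain b where b: "b \<in> e" "glue_class r (j, b) = {(i, a)}"
      by (auto simp: mem_edge_class_iff)
    thus "j = i \<and> a \<in> e"
      using glue_class_singleton_eqD[OF a b(2)] by simp
  next
    assume "j = i \<and> a \<in> e"
    thus "{(i, a)} \<in> edge_class r (j, e)"
      using a by (auto simp: mem_edge_class_iff)
  qed
  hence "{e \<in> edges (identify r (disjoint_copies I G)). {(i, a)} \<in> e} =
      edge_class r ` ({i} \<times> {e \<in> edges G. a \<in> e})"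
    unfolding edges_identify_copies using i by force
  moreover have "inj_on (edge_class r) ({i} \<times> {e \<in> edges G. a \<in> e})"
    by (rule inj_on_subset[OF inj]) (use i in auto)
  ultimately show ?thesis
    by (simp add: degree_def card_image card_cartesian_product)
qed

theorem theorem3p1:
  fixes q h k :: nat and S :: "(nat \<times> nat) set ugraph"
  assumes "q > 0" and "h > 0" and "k > 0"
    and "h \<ge> 2" and "real h \<le> real q / 2"
    and "is_spiro_chain q h k S"
  shows "ABC S = real q * real k / sqrt 2"
proof -
  let ?C = "cycle_graph q"
  have q: "q \<ge> 3"
    using assms(4,5) by linarith
  from assms(6) obtain x y where
    xy: "\<And>i. i \<in> {1..k} \<Longrightarrow> gdist ?C (x i) (y i) = h"
    and S: "S = identify (spiro_glue k x y) (disjoint_copies {1..k} ?C)"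
    unfolding is_spiro_chain_def by blast
  let ?r = "spiro_glue k x y"
  have ne: "x i \<noteq> y i" and nonadj: "{x i, y i} \<notin> edges ?C" if "i \<in> {1..k}" for i
    using gdist_ge_2D[of ?C "x i" "y i"] xy[OF that] assms(4) by auto
  have cls: "glue_class ?r u = {w. u = w \<or> ?r u w \<or> ?r w u}" for u
    unfolding glue_class_def using equivclp_spiro_glue[of k x y] ne by blast
  have inj: "inj (\<lambda>a. glue_class ?r (i, a))" for i
  proof (rule injI)
    fix a b assume "glue_class ?r (i, a) = glue_class ?r (i, b)"
    hence "(i, b) \<in> glue_class ?r (i, a)"
      by (simp add: cls)
    \<comment> \<open>Vertices are glued only across consecutive copies.\<close>
    thus "a = b"
      by (auto simp: cls spiro_glue_def)
  qed
  have free: "\<exists>a\<in>e. glue_class ?r (i, a) = {(i, a)}" if i: "i \<in> {1..k}" and e: "e \<in> edges ?C" for i e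
  proof -
    have "card e = 2"
      using finite_simple_graph_cycle[OF q] e by (simp add: finite_simple_graph_def)
    then obtain a b where ab: "e = {a, b}" "a \<noteq> b"
      by (auto simp: card_2_iff)
    have "e \<noteq> {x i, y i}"
      using nonadj[OF i] e by auto
    then obtain c where c: "c \<in> e" "c \<noteq> x i" "c \<noteq> y i"
      using ab by blast
    hence "glue_class ?r (i, c) = {(i, c)}"
      by (auto simp: cls spiro_glue_def)
    thus ?thesis
      using c(1) by blast
  qed
  have inj_edge: "inj_on (edge_class ?r) ({1..k} \<times> edges ?C)"
    by (rule inj_on_edge_class) (use inj free in auto)
  have "\<exists>v\<in>f. degree S v = 2" if f: "f \<in> edges S" for f
  proof -
    obtain i e where ie: "i \<in> {1..k}" "e \<in> edges ?C" "f = edge_class ?r (i, e)"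
      using f unfolding S edges_identify_copies by blast
    obtain a where a: "a \<in> e" "glue_class ?r (i, a) = {(i, a)}"
      using free ie(1,2) by blast
    have "a < q"
      using finite_simple_graph_cycle[OF q] ie(2) a(1)
      by (auto simp: finite_simple_graph_def cycle_graph_def)
    hence "degree S {(i, a)} = 2"
      unfolding S using degree_identify_singleton_class[OF ie(1) a(2) inj_edge]
        degree_cycle_graph[OF q] by simp
    moreover have "{(i, a)} \<in> f"
      using a ie(3) by (auto simp: mem_edge_class_iff)
    ultimately show ?thesis
      by blast
  qed
  moreover have "finite_simple_graph S"
    using finite_simple_graph_spiro_chain assms(4-6) by blast
  ultimately have "ABC S = real (card (edges S)) / sqrt 2"
    by (intro ABC_eq_if_degree_2_endpoints)
  moreover have "card (edges S) = k * q"
    unfolding S edges_identify_copies card_image[OF inj_edge]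
    by (simp add: card_cartesian_product card_edges_cycle_graph[OF q])
  ultimately show ?thesis
    by simp
qed

end
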